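(* Let $(X,T)$ be a surjective topological dynamical system (i.e. $T(X)=X$). Then $(X,T)$ has the asymptotic average shadowing property if and only if $(X,T)$ is Besicovitch complete and has the average shadowing property.
   Context: $\mathbb{N}_0=\{0,1,2,\ldots\}$ and $\mathbb{N}=\{1,2,\ldots\}$. A topological dynamical system $(X,T)$ consists of a compact metrizable space $X$ and a continuous map $T\colon X\to X$. Fix a compatible metric $\rho$ on $X$ of diameter at most $1$ (the notions below do not depend on this choice). $X^\infty$ is the set of all sequences $\underline{x}=\{x_n\}_{n=0}^\infty$ in $X$. For $z\in X$ put $\underline{z}_T=\{T^n(z)\}_{n=0}^\infty$. For $\underline{x},\underline{z}\in X^\infty$ let $\rho_B(\underline{x},\underline{z})=\limsup_{n\to\infty}\frac1n\sum_{i=0}^{n-1}\rho(x_i,z_i)$, and for $x,z\in X$ let $\rho_B^T(x,z)=\rho_B(\underline{x}_T,\underline{z}_T)$ (the dynamical Besicovitch pseudometric). Besicovitch complete: a sequence $\{z^{(n)}\}_{n=1}^\infty\subset X$ is Besicovitch-Cauchy if for every $\varepsilon>0$ there is $N$ with $\rho_B^T(z^{(n)},z^{(m)})<\varepsilon$ for all $n,m\ge N$; $(X,T)$ is Besicovitch complete if for every Besicovitch-Cauchy sequence there is $z\in X$ (not necessarily unique) with $\lim_{n\to\infty}\rho_B^T(z^{(n)},z)=0$. $\delta$-average pseudo-orbit: $\underline{x}\in X^\infty$ for which there is $N\in\mathbb{N}$ such that for all $n\ge N$ and $k\in\mathbb{N}_0$, $\frac1n\sum_{i=0}^{n-1}\rho(T(x_{i+k}),x_{i+k+1})<\delta$.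 Average shadowing property: for every $\varepsilon>0$ there is $\delta>0$ such that for every $\delta$-average pseudo-orbit $\underline{x}$ in $(X,T)$ there is $z\in X$ with $\rho_B(\underline{z}_T,\underline{x})<\varepsilon$. Asymptotic average pseudo-orbit: $\underline{x}\in X^\infty$ with $\limsup_{n\to\infty}\frac1n\sum_{i=0}^{n-1}\rho(T(x_i),x_{i+1})=0$. Asymptotic average shadowing property: for every asymptotic average pseudo-orbit $\underline{x}$ in $(X,T)$ there is $z\in X$ with $\rho_B(\underline{z}_T,\underline{x})=0$. *)

theory Defs
  imports "HOL-Analysis.Analysis"
begin

definition topological_dynamical_system :: "'a topology \<Rightarrow> ('a \<Rightarrow> 'a) \<Rightarrow> bool" where
  "topological_dynamical_system X T \<longleftrightarrow>
     compact_space X \<and> metrizable_space X \<and> continuous_map X X T"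

definition compatible_metric :: "'a topology \<Rightarrow> ('a \<Rightarrow> 'a \<Rightarrow> real) \<Rightarrow> bool" where
  "compatible_metric X \<rho> \<longleftrightarrow>
     Metric_space (topspace X) \<rho> \<and> Metric_space.mtopology (topspace X) \<rho> = X"

definition orbit_seq :: "('a \<Rightarrow> 'a) \<Rightarrow> 'a \<Rightarrow> nat \<Rightarrow> 'a" where
  "orbit_seq T z = (\<lambda>n. (T ^^ n) z)"

text \<open>
  The limit superior is taken in the extended reals, where it always exists; its value is a
  real number in the unit interval whenever both sequences lie in a space of diameter at most 1.
  The junk term at \<open>n = 0\<close> (division by zero) does not affect it.
\<close>

definition besicovitch_seq :: "('a \<Rightarrow> 'a \<Rightarrow> real) \<Rightarrow> (nat \<Rightarrow> 'a) \<Rightarrow> (nat \<Rightarrow> 'a) \<Rightarrow> ereal" where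
  "besicovitch_seq \<rho> x z = limsup (\<lambda>n. ereal (1 / real n * (\<Sum>i<n. \<rho> (x i) (z i))))"

definition besicovitch :: "('a \<Rightarrow> 'a \<Rightarrow> real) \<Rightarrow> ('a \<Rightarrow> 'a) \<Rightarrow> 'a \<Rightarrow> 'a \<Rightarrow> ereal" where
  "besicovitch \<rho> T x z = besicovitch_seq \<rho> (orbit_seq T x) (orbit_seq T z)"

text \<open>
  Sequences of points are indexed from 1 here, so the value at index 0 is unconstrained.
\<close>

definition besicovitch_Cauchy :: "('a \<Rightarrow> 'a \<Rightarrow> real) \<Rightarrow> ('a \<Rightarrow> 'a) \<Rightarrow> (nat \<Rightarrow> 'a) \<Rightarrow> bool" where
  "besicovitch_Cauchy \<rho> T z \<longleftrightarrow>
     (\<forall>\<epsilon>::real. \<epsilon> > 0 \<longrightarrow>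
        (\<exists>N\<ge>1. \<forall>n\<ge>N. \<forall>m\<ge>N. besicovitch \<rho> T (z n) (z m) < ereal \<epsilon>))"

definition besicovitch_complete :: "'a topology \<Rightarrow> ('a \<Rightarrow> 'a \<Rightarrow> real) \<Rightarrow> ('a \<Rightarrow> 'a) \<Rightarrow> bool" where
  "besicovitch_complete X \<rho> T \<longleftrightarrow>
     (\<forall>z. (\<forall>n\<ge>1. z n \<in> topspace X) \<longrightarrow> besicovitch_Cauchy \<rho> T z \<longrightarrow>
        (\<exists>w\<in>topspace X. (\<lambda>n. besicovitch \<rho> T (z n) w) \<longlonglongrightarrow> 0))"

definition average_pseudo_orbit ::
    "'a topology \<Rightarrow> ('a \<Rightarrow> 'a \<Rightarrow> real) \<Rightarrow> ('a \<Rightarrow> 'a) \<Rightarrow> real \<Rightarrow> (nat \<Rightarrow> 'a) \<Rightarrow> bool" where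
  "average_pseudo_orbit X \<rho> T \<delta> x \<longleftrightarrow>
     (\<forall>n. x n \<in> topspace X) \<and>
     (\<exists>N\<ge>1. \<forall>n\<ge>N. \<forall>k. 1 / real n * (\<Sum>i<n. \<rho> (T (x (i + k))) (x (i + k + 1))) < \<delta>)"

definition average_shadowing :: "'a topology \<Rightarrow> ('a \<Rightarrow> 'a \<Rightarrow> real) \<Rightarrow> ('a \<Rightarrow> 'a) \<Rightarrow> bool" where
  "average_shadowing X \<rho> T \<longleftrightarrow>
     (\<forall>\<epsilon>::real. \<epsilon> > 0 \<longrightarrow>
        (\<exists>\<delta>>0. \<forall>x. average_pseudo_orbit X \<rho> T \<delta> x \<longrightarrow>
           (\<exists>z\<in>topspace X. besicovitch_seq \<rho> (orbit_seq T z) x < ereal \<epsilon>)))"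

definition asymptotic_average_pseudo_orbit ::
    "'a topology \<Rightarrow> ('a \<Rightarrow> 'a \<Rightarrow> real) \<Rightarrow> ('a \<Rightarrow> 'a) \<Rightarrow> (nat \<Rightarrow> 'a) \<Rightarrow> bool" where
  "asymptotic_average_pseudo_orbit X \<rho> T x \<longleftrightarrow>
     (\<forall>n. x n \<in> topspace X) \<and>
     limsup (\<lambda>n. ereal (1 / real n * (\<Sum>i<n. \<rho> (T (x i)) (x (i + 1))))) = 0"

definition asymptotic_average_shadowing ::
    "'a topology \<Rightarrow> ('a \<Rightarrow> 'a \<Rightarrow> real) \<Rightarrow> ('a \<Rightarrow> 'a) \<Rightarrow> bool" where
  "asymptotic_average_shadowing X \<rho> T \<longleftrightarrow>
     (\<forall>x. asymptotic_average_pseudo_orbit X \<rho> T x \<longrightarrow>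
        (\<exists>z\<in>topspace X. besicovitch_seq \<rho> (orbit_seq T z) x = 0))"

end

theory Submission
  imports Defs
begin

text \<open>
  From asymptotic average shadowing, both properties follow by joining pieces on intervals
  \<open>[S\<^sub>k, S\<^sub>k\<^sub>+\<^sub>1)\<close> with \<open>S\<close> growing superexponentially. Joining the orbits of a rapidly
  Besicovitch-Cauchy sequence gives an asymptotic average pseudo-orbit that is their Besicovitch
  limit, and a point shadowing it is a limit of the Cauchy sequence. If average shadowing failed for
  \<open>\<epsilon>\<close>, there would be \<open>1/(k+1)\<close>-average pseudo-orbits that no point \<open>\<epsilon>\<close>-shadows; by compactness
  this failure is witnessed within a bounded time, so a point shadowing the sequence joined from
  sufficiently long initial segments of them yields a contradiction.

  Conversely, an asymptotic average pseudo-orbit agrees off a set of density zero with a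
  \<open>\<delta>\<close>-average pseudo-orbit, for each \<open>\<delta> > 0\<close>. Average shadowing then provides points
  approximating it in the Besicovitch pseudometric; they form a Besicovitch-Cauchy sequence, whose
  limit shadows it.
\<close>

section \<open>Eventual bounds on averages\<close>

text \<open>Stands in for bounds on the limsup of averages, free of extended reals and of division
  by \<open>n\<close>: limsup below \<open>c\<close> implies it, and it implies limsup at most
  \<open>c\<close>. The gap at equality is harmless, since every estimate is made for all positive
  \<open>c\<close> or with room to spare.\<close>

definition mean_le :: "(nat \<Rightarrow> real) \<Rightarrow> real \<Rightarrow> bool" where
  "mean_le e c \<longleftrightarrow> (\<forall>\<^sub>F n in sequentially. (\<Sum>i<n. e i) \<le> c * real n)"

lemma mean_le_triangle:
  assumes "mean_le f a" "mean_le g b" "\<And>i. e i \<le> f i + g i"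
  shows "mean_le e (a + b)"
  using assms(1,2) unfolding mean_le_def
proof eventually_elim
  case (elim n)
  have "(\<Sum>i<n. e i) \<le> (\<Sum>i<n. f i) + (\<Sum>i<n. g i)"
    unfolding sum.distrib[symmetric] by (intro sum_mono assms(3))
  with elim show ?case by (simp add: algebra_simps)
qed

lemma limsup_mean_le:
  assumes "mean_le e c"
  shows "limsup (\<lambda>n. ereal (1 / real n * (\<Sum>i<n. e i))) \<le> ereal c"
proof (rule Limsup_bounded)
  show "\<forall>\<^sub>F n in sequentially. ereal (1 / real n * (\<Sum>i<n. e i)) \<le> ereal c"
    using assms[unfolded mean_le_def] eventually_gt_at_top[of 0]
    by eventually_elim (simp add: field_simps)
qed

lemma limsup_mean_lessD:
  assumes "limsup (\<lambda>n. ereal (1 / real n * (\<Sum>i<n. e i))) < ereal c"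
  shows "mean_le e c"
proof -
  have "\<forall>\<^sub>F n in sequentially. ereal (1 / real n * (\<Sum>i<n. e i)) < ereal c"
    using Limsup_lessD[OF assms] .
  then show ?thesis
    unfolding mean_le_def using eventually_gt_at_top[of 0]
    by eventually_elim (simp add: field_simps)
qed

lemma limsup_mean_nonneg:
  assumes "\<And>i. 0 \<le> e i"
  shows "0 \<le> limsup (\<lambda>n. ereal (1 / real n * (\<Sum>i<n. e i)))"
proof (rule le_Limsup)
  have "0 \<le> (\<Sum>i<n. e i)" for n by (intro sum_nonneg assms)
  then show "\<forall>\<^sub>F n in sequentially. 0 \<le> ereal (1 / real n * (\<Sum>i<n. e i))" by simp
qed simp

lemma limsup_mean_eq_0_iff:
  assumes "\<And>i. 0 \<le> e i"
  shows "limsup (\<lambda>n. ereal (1 / real n * (\<Sum>i<n. e i))) = 0 \<longleftrightarrow> (\<forall>c>0. mean_le e c)"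
    (is "?L = 0 \<longleftrightarrow> _")
proof
  assume "?L = 0"
  then show "\<forall>c>0. mean_le e c"
    by (intro allI impI limsup_mean_lessD) simp
next
  assume e: "\<forall>c>0. mean_le e c"
  have "?L \<le> 0"
    by (rule ereal_le_epsilon2) (use e limsup_mean_le in force)
  then show "?L = 0"
    using limsup_mean_nonneg[OF assms] by (simp add: order_antisym)
qed

section \<open>Sequences joined along fast growing breakpoints\<close>

text \<open>The free lower bound \<open>F\<close> may depend on the previous breakpoint, so a piece
  can be made long enough for thresholds known only once its starting time is fixed.\<close>

lemma fast_sequence_exists:
  fixes F :: "nat \<Rightarrow> nat \<Rightarrow> nat"
  obtains S :: "nat \<Rightarrow> nat" where "S 0 = 0" "strict_mono S"
    "\<And>k. Suc k * S k \<le> S (Suc k)" "\<And>k. F k (S k) \<le> S (Suc k)"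
proof -
  define S where "S = rec_nat 0 (\<lambda>k s. Suc (Suc k * s + F k s))"
  have S: "S 0 = 0" "\<And>k. S (Suc k) = Suc (Suc k * S k + F k (S k))"
    by (simp_all add: S_def)
  show thesis
    by (rule that[of S]) (auto simp: S strict_mono_Suc_iff)
qed

lemma strict_mono_piece:
  fixes S :: "nat \<Rightarrow> nat"
  assumes "S 0 = 0" "strict_mono S"
  obtains k where "S k \<le> n" "n < S (Suc k)"
proof -
  define k where "k = (LEAST k. n < S (Suc k))"
  have ex: "n < S (Suc n)"
    using strict_mono_imp_increasing[OF assms(2), of "Suc n"] by simp
  have 1: "n < S (Suc k)"
    unfolding k_def by (rule LeastI[of _ n]) (rule ex)
  have 2: "S k \<le> n"
  proof (cases k)
    case 0
    then show ?thesis using assms by simp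
  next
    case (Suc j)
    then have "\<not> n < S (Suc j)"
      using not_less_Least[of j "\<lambda>k. n < S (Suc k)"] by (simp add: k_def)
    with Suc show ?thesis by simp
  qed
  from that 1 2 show thesis by blast
qed

text \<open>Pieces are indexed by absolute time, so orbits can be joined without a shift; a piece
  that restarts at its breakpoint must carry the shift itself.\<close>

definition join_pieces :: "(nat \<Rightarrow> nat) \<Rightarrow> (nat \<Rightarrow> nat \<Rightarrow> 'a) \<Rightarrow> nat \<Rightarrow> 'a" where
  "join_pieces S P i = P (LEAST k. i < S (Suc k)) i"

lemma join_pieces_eq:
  assumes "strict_mono S" "S k \<le> i" "i < S (Suc k)"
  shows "join_pieces S P i = P k i"
proof -
  have "(LEAST k. i < S (Suc k)) = k"
  proof (rule Least_equality)
    fix j assume "i < S (Suc j)"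
    then have "S k < S (Suc j)" using assms by linarith
    then show "k \<le> j" using assms(1) by (simp add: strict_mono_less)
  qed fact
  then show ?thesis by (simp add: join_pieces_def)
qed

text \<open>Since the breakpoints grow superexponentially, only the last two pieces contribute.\<close>

lemma mean_le_pieces:
  assumes S: "S 0 = 0" "strict_mono S" "\<And>k. Suc k * S k \<le> S (Suc k)"
    and e: "\<And>i. e i \<le> 1"
    and c: "c > 0"
    and piece: "\<And>k n. k \<ge> K \<Longrightarrow> S k \<le> n \<Longrightarrow> n \<le> S (Suc k) \<Longrightarrow> (\<Sum>i\<in>{S k..<n}. e i) \<le> c * real n"
  shows "mean_le e (3 * c)"
proof -
  \<comment> \<open>For \<open>j\<close> beyond \<open>K'\<close>, the growth of \<open>S\<close>
    bounds the part before \<open>S j\<close> by \<open>n / (j + 1)\<close>, which is at most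
    \<open>c * n\<close>.\<close>
  obtain K' :: nat where K': "1 / c < real K'" using reals_Archimedean2 by blast
  show ?thesis unfolding mean_le_def
  proof (rule eventually_sequentiallyI)
    fix n assume n: "n \<ge> S (Suc (K + K'))"
    obtain k where k: "S k \<le> n" "n < S (Suc k)"
      using strict_mono_piece[OF S(1,2)] .
    have "S (Suc (K + K')) < S (Suc k)" using n k by linarith
    then have kK: "K + K' < k" using S(2) by (simp add: strict_mono_less)
    then obtain j where j: "k = Suc j" by (cases k) auto
    have jK: "j \<ge> K" "j \<ge> K'" using kK j by auto
    have le: "S j \<le> S k" using S(2) j by (simp add: strict_mono_less_eq)
    \<comment> \<open>The factor 3 comes from these three sums: everything before piece
      \<open>j\<close>, the full piece \<open>j\<close>, and the started piece
      \<open>k\<close>.\<close>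
    have "(\<Sum>i<n. e i) = (\<Sum>i<S j. e i) + (\<Sum>i\<in>{S j..<S k}. e i) + (\<Sum>i\<in>{S k..<n}. e i)"
      using le k(1) by (simp add: lessThan_atLeast0 sum.atLeastLessThan_concat)
    moreover have "(\<Sum>i<S j. e i) \<le> c * real n"
    proof -
      have "(\<Sum>i<S j. e i) \<le> (\<Sum>i<S j. 1)" by (intro sum_mono e)
      also have "\<dots> = real (S j)" by simp
      also have "\<dots> \<le> c * real (Suc j) * real (S j)"
      proof -
        have "1 / c \<le> real (Suc j)" using K' jK by linarith
        then have "1 \<le> c * real (Suc j)" using c by (simp add: field_simps)
        then show ?thesis
          by (metis mult_right_mono mult_1 of_nat_0_le_iff)
      qed
      also have "\<dots> = c * real (Suc j * S j)" by (simp only: of_nat_mult mult.assoc)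
      also have "\<dots> \<le> c * real n"
        using S(3)[of j] k j c by (intro mult_left_mono iffD2[OF of_nat_le_iff]) auto
      finally show ?thesis .
    qed
    moreover have "(\<Sum>i\<in>{S j..<S k}. e i) \<le> c * real n"
    proof -
      have "(\<Sum>i\<in>{S j..<S k}. e i) \<le> c * real (S k)"
        using piece[of j "S k"] jK j le by simp
      also have "\<dots> \<le> c * real n" using c k by (intro mult_left_mono) auto
      finally show ?thesis .
    qed
    moreover have "(\<Sum>i\<in>{S k..<n}. e i) \<le> c * real n"
      using piece[of k n] k jK j by simp
    ultimately show "(\<Sum>i<n. e i) \<le> 3 * c * real n" by simp
  qed
qed

lemma sum_blocks_le:
  fixes f :: "nat \<Rightarrow> real"
  assumes "\<And>j. (\<Sum>i\<in>{j*L..<j*L+L}. f i) \<le> a"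
  shows "(\<Sum>i\<in>{p*L..<(p+r)*L}. f i) \<le> real r * a"
proof (induction r)
  case (Suc r)
  have "{p*L..<(p+Suc r)*L} = {p*L..<(p+r)*L} \<union> {(p+r)*L..<(p+r)*L+L}"
    by (auto simp: algebra_simps)
  then have "(\<Sum>i\<in>{p*L..<(p+Suc r)*L}. f i)
      = (\<Sum>i\<in>{p*L..<(p+r)*L}. f i) + (\<Sum>i\<in>{(p+r)*L..<(p+r)*L+L}. f i)"
    by (simp, subst sum.union_disjoint) auto
  with Suc assms[of "p+r"] show ?case by (simp add: algebra_simps)
qed simp

section \<open>Compact systems with a metric bounded by 1\<close>

locale bounded_compact_system = Metric_space M d
  for M :: "'a set" and d :: "'a \<Rightarrow> 'a \<Rightarrow> real" +
  fixes T :: "'a \<Rightarrow> 'a"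
  assumes compact: "compact_space mtopology"
    and cont: "continuous_map mtopology mtopology T"
    and d_le_1: "\<And>x y. x \<in> M \<Longrightarrow> y \<in> M \<Longrightarrow> d x y \<le> 1"
begin

lemma T_in [intro]: "x \<in> M \<Longrightarrow> T x \<in> M"
  using cont by (auto simp: continuous_map_def)

lemma orbit_in [intro]: "x \<in> M \<Longrightarrow> orbit_seq T x n \<in> M"
  by (induction n) (auto simp: orbit_seq_def)

lemma orbit_Suc: "orbit_seq T x (Suc n) = T (orbit_seq T x n)"
  by (simp add: orbit_seq_def)

lemma orbit_funpow: "orbit_seq T ((T ^^ s) z) n = orbit_seq T z (s + n)"
  by (simp add: orbit_seq_def add.commute[of s n] funpow_add)

lemma continuous_orbit: "continuous_map mtopology mtopology (\<lambda>x. orbit_seq T x n)"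
proof (induction n)
  case (Suc n)
  then show ?case
    using continuous_map_compose[OF Suc cont] by (simp add: orbit_Suc o_def)
qed (simp add: orbit_seq_def continuous_map_id[unfolded id_def])

lemma mean_le_dist_trans:
  assumes "\<And>i. x i \<in> M" "\<And>i. y i \<in> M" "\<And>i. z i \<in> M"
    and "mean_le (\<lambda>i. d (x i) (y i)) a" "mean_le (\<lambda>i. d (y i) (z i)) b"
  shows "mean_le (\<lambda>i. d (x i) (z i)) (a + b)"
  by (rule mean_le_triangle[OF assms(4,5)]) (intro triangle assms)

lemma besicovitch_seq_eq_0_iff:
  "besicovitch_seq d x z = 0 \<longleftrightarrow> (\<forall>c>0. mean_le (\<lambda>i. d (x i) (z i)) c)"
  unfolding besicovitch_seq_def by (rule limsup_mean_eq_0_iff) simp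

lemma besicovitch_seq_le:
  "mean_le (\<lambda>i. d (x i) (z i)) c \<Longrightarrow> besicovitch_seq d x z \<le> ereal c"
  unfolding besicovitch_seq_def by (rule limsup_mean_le)

lemma besicovitch_seq_lessD:
  "besicovitch_seq d x z < ereal c \<Longrightarrow> mean_le (\<lambda>i. d (x i) (z i)) c"
  unfolding besicovitch_seq_def by (rule limsup_mean_lessD)

lemma asymptotic_average_pseudo_orbit_iff:
  "asymptotic_average_pseudo_orbit mtopology d T x \<longleftrightarrow>
     (\<forall>n. x n \<in> M) \<and> (\<forall>c>0. mean_le (\<lambda>i. d (T (x i)) (x (Suc i))) c)"
  unfolding asymptotic_average_pseudo_orbit_def
  by (subst limsup_mean_eq_0_iff) auto

text \<open>Inside a piece the error is that of \<open>P k\<close>. The only other error is the jump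
  at the end of the piece, at most 1 and hence negligible against \<open>n\<close> for late
  pieces.\<close>

lemma asymptotic_average_pseudo_orbit_join_pieces:
  assumes S: "S 0 = 0" "strict_mono S" "\<And>k. Suc k * S k \<le> S (Suc k)"
    and P: "\<And>k i. P k i \<in> M"
    and piece: "\<And>c. c > 0 \<Longrightarrow> \<exists>K. \<forall>k\<ge>K. \<forall>n. S k \<le> n \<longrightarrow> n \<le> S (Suc k) \<longrightarrow>
      (\<Sum>i\<in>{S k..<n}. d (T (P k i)) (P k (Suc i))) \<le> c * real n"
  shows "asymptotic_average_pseudo_orbit mtopology d T (join_pieces S P)"
  unfolding asymptotic_average_pseudo_orbit_iff
proof (intro conjI allI impI)
  have xM: "join_pieces S P i \<in> M" for i by (simp add: join_pieces_def P)
  then show "join_pieces S P i \<in> M" for i .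
  fix c :: real assume "c > 0"
  let ?e = "\<lambda>i. d (T (join_pieces S P i)) (join_pieces S P (Suc i))"
  \<comment> \<open>\<open>mean_le_pieces\<close> costs a factor 3, so each piece may use
    \<open>c/3\<close>: half for the errors of \<open>P k\<close>, half for the jump.\<close>
  obtain K where K: "\<And>k n. \<lbrakk>k \<ge> K; S k \<le> n; n \<le> S (Suc k)\<rbrakk> \<Longrightarrow>
      (\<Sum>i\<in>{S k..<n}. d (T (P k i)) (P k (Suc i))) \<le> c/6 * real n"
    using piece[of "c/6"] \<open>c > 0\<close> by auto
  obtain K' :: nat where K': "6 / c < real K'" using reals_Archimedean2 by blast
  have "mean_le ?e (3 * (c/3))"
  proof (rule mean_le_pieces[OF S])
    show "?e i \<le> 1" for i by (intro d_le_1 T_in xM)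
    show "c / 3 > 0" using \<open>c > 0\<close> by simp
    fix k n assume k: "K + K' \<le> k" "S k \<le> n" "n \<le> S (Suc k)"
    \<comment> \<open>Charges the last time of piece \<open>k\<close>, whose successor is already
      read from the next piece.\<close>
    let ?b = "\<lambda>i. if i = S (Suc k) - 1 then 1 else 0 :: real"
    have "(\<Sum>i\<in>{S k..<n}. ?e i) \<le> (\<Sum>i\<in>{S k..<n}. d (T (P k i)) (P k (Suc i)) + ?b i)"
    proof (rule sum_mono)
      fix i assume i: "i \<in> {S k..<n}"
      have 1: "join_pieces S P i = P k i" using i k by (intro join_pieces_eq S) auto
      show "?e i \<le> d (T (P k i)) (P k (Suc i)) + ?b i"
      proof (cases "i = S (Suc k) - 1")
        case True
        have "?e i \<le> 1" by (intro d_le_1 T_in xM)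
        then show ?thesis using True nonneg[of "T (P k i)" "P k (Suc i)"]
          by (simp del: nonneg)
      next
        case False
        then have "join_pieces S P (Suc i) = P k (Suc i)" using i k by (intro join_pieces_eq S) auto
        then show ?thesis using 1 by simp
      qed
    qed
    also have "\<dots> = (\<Sum>i\<in>{S k..<n}. d (T (P k i)) (P k (Suc i))) + (\<Sum>i\<in>{S k..<n}. ?b i)"
      by (rule sum.distrib)
    also have "(\<Sum>i\<in>{S k..<n}. ?b i) \<le> 1" by (simp add: sum.delta)
    also have "1 \<le> c / 6 * real n"
    proof -
      have "6 / c < real n"
        using K' k strict_mono_imp_increasing[OF S(2), of k] by linarith
      then show ?thesis using \<open>c > 0\<close> by (simp add: field_simps)
    qed
    also have "(\<Sum>i\<in>{S k..<n}. d (T (P k i)) (P k (Suc i))) \<le> c/6 * real n"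
      using K k by simp
    finally show "(\<Sum>i\<in>{S k..<n}. ?e i) \<le> c / 3 * real n" by simp
  qed
  then show "mean_le ?e c" by simp
qed

section \<open>Asymptotic average shadowing implies Besicovitch completeness\<close>

lemma asymptotic_shadowing_imp_complete:
  assumes shadow: "asymptotic_average_shadowing mtopology d T"
  shows "besicovitch_complete mtopology d T"
  unfolding besicovitch_complete_def topspace_mtopology
proof (intro allI impI)
  fix z assume zM: "\<forall>n\<ge>1. z n \<in> M" and Cauchy: "besicovitch_Cauchy d T z"
  have "\<forall>k. \<exists>N\<ge>1. \<forall>n\<ge>N. \<forall>m\<ge>N. besicovitch d T (z n) (z m) < ereal (1 / real (Suc k))"
    using Cauchy unfolding besicovitch_Cauchy_def by (auto simp del: of_nat_Suc)
  then obtain N where N: "\<And>k. N k \<ge> 1"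
      "\<And>k n m. n \<ge> N k \<Longrightarrow> m \<ge> N k \<Longrightarrow> besicovitch d T (z n) (z m) < ereal (1 / real (Suc k))"
    by metis
  \<comment> \<open>The maximum places \<open>r k\<close> beyond \<open>N j\<close> for every
    \<open>j\<close> up to \<open>k\<close>, so the orbits \<open>w j\<close> and \<open>w k\<close>
    are within \<open>1 / (j + 1)\<close> for all such pairs.\<close>
  define r where "r k = Max (N ` {..k})" for k
  have r: "N j \<le> r k" if "j \<le> k" for j k using that by (auto simp: r_def)
  define w where "w k = orbit_seq T (z (r k))" for k
  have r1: "r k \<ge> 1" for k using r[of k k] N(1)[of k] by linarith
  have wM: "w k i \<in> M" for k i using r1 zM by (auto simp: w_def)
  have w: "mean_le (\<lambda>i. d (w j i) (w k i)) (1 / real (Suc j))" if "j \<le> k" for j k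
    using besicovitch_seq_lessD N(2)[of j "r j" "r k"] r that
    unfolding besicovitch_def w_def by blast
  have "\<forall>j k. \<exists>R. j \<le> k \<longrightarrow> (\<forall>n\<ge>R. (\<Sum>i<n. d (w j i) (w k i)) \<le> 1 / real (Suc j) * real n)"
    using w unfolding mean_le_def eventually_sequentially by blast
  then obtain R where R: "\<And>j k n. j \<le> k \<Longrightarrow> R j k \<le> n \<Longrightarrow>
      (\<Sum>i<n. d (w j i) (w k i)) \<le> 1 / real (Suc j) * real n"
    by metis
  \<comment> \<open>Piece \<open>Suc k\<close> starts only after its orbit has become close on
    average to all earlier ones. Piece 0 gets no such guarantee.\<close>
  obtain S where S: "S 0 = 0" "strict_mono S" "\<And>k. Suc k * S k \<le> S (Suc k)"
      "\<And>k. Max ((\<lambda>j. R j (Suc k)) ` {..Suc k}) \<le> S (Suc k)"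
    using fast_sequence_exists[of "\<lambda>k _. Max ((\<lambda>j. R j (Suc k)) ` {..Suc k})"] by metis
  have RS: "R j k \<le> S k" if "j \<le> k" "1 \<le> k" for j k
    using S(4)[of "k - 1"] that by auto
  let ?x = "join_pieces S w"
  have wT: "T (w k i) = w k (Suc i)" for k i by (simp add: w_def orbit_Suc)
  have xM: "?x i \<in> M" for i by (simp add: join_pieces_def wM)
  \<comment> \<open>The pieces are genuine orbits, so their internal errors vanish.\<close>
  have "asymptotic_average_pseudo_orbit mtopology d T ?x"
    by (rule asymptotic_average_pseudo_orbit_join_pieces[OF S(1-3) wM]) (auto simp: wT wM)
  then obtain y where y: "y \<in> M" "besicovitch_seq d (orbit_seq T y) ?x = 0"
    using shadow unfolding asymptotic_average_shadowing_def by auto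
  then have yx: "mean_le (\<lambda>i. d (?x i) (orbit_seq T y i)) c" if "c > 0" for c
    using that by (simp add: besicovitch_seq_eq_0_iff commute)
  have wx: "mean_le (\<lambda>i. d (w j i) (?x i)) (3 * (1 / real (Suc j)))" for j
  proof (rule mean_le_pieces[OF S(1-3)])
    show "d (w j i) (?x i) \<le> 1" for i by (intro d_le_1 wM xM)
    fix k n assume k: "Suc j \<le> k" "S k \<le> n" "n \<le> S (Suc k)"
    have "(\<Sum>i\<in>{S k..<n}. d (w j i) (?x i)) = (\<Sum>i\<in>{S k..<n}. d (w j i) (w k i))"
      using k by (intro sum.cong refl) (simp add: join_pieces_eq[OF S(2), of k])
    also have "\<dots> \<le> (\<Sum>i<n. d (w j i) (w k i))" by (intro sum_mono2) auto
    also have "\<dots> \<le> 1 / real (Suc j) * real n"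
      using k RS[of j k] by (intro R) auto
    finally show "(\<Sum>i\<in>{S k..<n}. d (w j i) (?x i)) \<le> 1 / real (Suc j) * real n" .
  qed simp
  have wy: "mean_le (\<lambda>i. d (w j i) (orbit_seq T y i)) (3 * (1 / real (Suc j)) + 1 / real (Suc j))" for j
    by (rule mean_le_dist_trans[OF wM xM _ wx yx]) (use y in auto)
  have "(\<lambda>n. besicovitch d T (z n) y) \<longlonglongrightarrow> 0"
  proof (rule order_tendstoI)
    fix a :: ereal assume "a < 0"
    then show "\<forall>\<^sub>F n in sequentially. a < besicovitch d T (z n) y"
      unfolding besicovitch_def besicovitch_seq_def
      by (intro always_eventually allI less_le_trans[OF _ limsup_mean_nonneg]) auto
  next
    fix a :: ereal assume "0 < a"
    then obtain c where c: "0 < ereal c" "ereal c < a"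
      using ereal_dense2 by blast
    \<comment> \<open>Five units of \<open>1 / (j + 1)\<close>: one from \<open>z n\<close> to
      \<open>w j\<close>, three from \<open>w j\<close> to the joined sequence, one from there to
      \<open>y\<close>.\<close>
    obtain j :: nat where j: "5 / c < real j" using reals_Archimedean2 by blast
    have "5 * (1 / real (Suc j)) \<le> c"
      using c j by (simp add: field_simps)
    show "\<forall>\<^sub>F n in sequentially. besicovitch d T (z n) y < a"
    proof (rule eventually_sequentiallyI)
      fix n assume n: "n \<ge> N j"
      then have znM: "z n \<in> M" using N(1)[of j] zM by auto
      have "mean_le (\<lambda>i. d (orbit_seq T (z n) i) (w j i)) (1 / real (Suc j))"
        using besicovitch_seq_lessD N(2)[of j n "r j"] n r[of j j]
        unfolding besicovitch_def w_def by blast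
      then have "mean_le (\<lambda>i. d (orbit_seq T (z n) i) (orbit_seq T y i))
          (1 / real (Suc j) + (3 * (1 / real (Suc j)) + 1 / real (Suc j)))"
        by (rule mean_le_dist_trans[rotated 3, OF _ wy]) (use znM wM y in auto)
      then have "besicovitch d T (z n) y \<le>
          ereal (1 / real (Suc j) + (3 * (1 / real (Suc j)) + 1 / real (Suc j)))"
        unfolding besicovitch_def by (rule besicovitch_seq_le)
      also have "\<dots> \<le> ereal c"
        unfolding ereal_less_eq using \<open>5 * (1 / real (Suc j)) \<le> c\<close> by argo
      finally show "besicovitch d T (z n) y < a" using c by order
    qed
  qed
  then show "\<exists>w\<in>M. (\<lambda>n. besicovitch d T (z n) w) \<longlonglongrightarrow> 0"
    using y by blast
qed

section \<open>Asymptotic average shadowing implies average shadowing\<close>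

text \<open>For fixed \<open>m\<close>, exceeding the bound at time \<open>m\<close> is an open
  condition on \<open>y\<close>, as only finitely many iterates enter. The sets for \<open>m\<close>
  at least \<open>s\<close> cover \<open>M\<close>, and a finite subcover bounds the time of
  failure.\<close>

lemma uniform_non_shadowing:
  assumes xM: "\<And>i. x i \<in> M"
    and no: "\<And>y. y \<in> M \<Longrightarrow> \<not> mean_le (\<lambda>i. d (orbit_seq T y i) (x i)) c"
  shows "\<exists>N. \<forall>y\<in>M. \<exists>m\<ge>s. m \<le> N \<and> c * real m < (\<Sum>i<m. d (orbit_seq T y i) (x i))"
proof -
  define U where "U m = {y \<in> M. (\<Sum>i<m. d (orbit_seq T y i) (x i)) \<in> {c * real m<..}}" for m
  have U: "openin mtopology (U m)" for m
  proof -
    have "continuous_map mtopology euclideanreal (\<lambda>y. \<Sum>i<m. d (orbit_seq T y i) (x i))"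
      using continuous_map_mdist[of mtopology "metric (M, d)"] continuous_orbit
      by (intro continuous_map_sum) (auto simp: xM)
    from openin_continuous_map_preimage[OF this, of "{c * real m<..}"] show ?thesis
      by (simp add: U_def)
  qed
  have cover: "M \<subseteq> \<Union>(U ` {s..})"
  proof
    fix y assume y: "y \<in> M"
    with no obtain m where "m \<ge> s" "\<not> (\<Sum>i<m. d (orbit_seq T y i) (x i)) \<le> c * real m"
      unfolding mean_le_def eventually_sequentially by blast
    then show "y \<in> \<Union>(U ` {s..})" using y by (intro UN_I[of m]) (auto simp: U_def)
  qed
  have "compactin mtopology M" using compact by (simp add: compact_space_def)
  then have "\<exists>\<F>. finite \<F> \<and> \<F> \<subseteq> U ` {s..} \<and> M \<subseteq> \<Union>\<F>"
    by (rule compactinD[OF _ _ cover]) (use U in auto)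
  then obtain \<F> where F: "finite \<F>" "\<F> \<subseteq> U ` {s..}" "M \<subseteq> \<Union>\<F>" by blast
  then obtain I where I: "finite I" "I \<subseteq> {s..}" "\<F> = U ` I"
    using finite_subset_image[of \<F> U "{s..}"] by blast
  show ?thesis
  proof (rule exI[of _ "Max I"], rule ballI)
    fix y assume "y \<in> M"
    then obtain m where "m \<in> I" "y \<in> U m" using F I by auto
    then show "\<exists>m\<ge>s. m \<le> Max I \<and> c * real m < (\<Sum>i<m. d (orbit_seq T y i) (x i))"
      using I by (intro exI[of _ m]) (auto simp: U_def)
  qed
qed

lemma asymptotic_shadowing_imp_average_shadowing:
  assumes shadow: "asymptotic_average_shadowing mtopology d T"
  shows "average_shadowing mtopology d T"
proof (rule ccontr)
  assume "\<not> ?thesis"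
  then obtain \<epsilon> where eps: "\<epsilon> > 0" and "\<forall>\<delta>>0. \<exists>x. average_pseudo_orbit mtopology d T \<delta> x \<and>
      (\<forall>z\<in>M. \<not> besicovitch_seq d (orbit_seq T z) x < ereal \<epsilon>)"
    unfolding average_shadowing_def by auto
  then have "\<forall>k. \<exists>x. average_pseudo_orbit mtopology d T (1 / real (Suc k)) x \<and>
      (\<forall>z\<in>M. \<not> besicovitch_seq d (orbit_seq T z) x < ereal \<epsilon>)"
    by (simp del: of_nat_Suc)
  then obtain x where x: "\<And>k. average_pseudo_orbit mtopology d T (1 / real (Suc k)) (x k)"
      "\<And>k z. z \<in> M \<Longrightarrow> \<not> besicovitch_seq d (orbit_seq T z) (x k) < ereal \<epsilon>"
    by metis
  have xM: "x k i \<in> M" for k i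
    using x(1)[of k] by (simp add: average_pseudo_orbit_def)
  have "\<forall>k. \<exists>N\<ge>1. \<forall>n\<ge>N. 1 / real n * (\<Sum>i<n. d (T (x k i)) (x k (Suc i))) < 1 / real (Suc k)"
  proof
    fix k
    from x(1)[of k] obtain N where "N \<ge> 1" and N: "\<And>n l. n \<ge> N \<Longrightarrow>
        1 / real n * (\<Sum>i<n. d (T (x k (i + l))) (x k (i + l + 1))) < 1 / real (Suc k)"
      unfolding average_pseudo_orbit_def by blast
    then show "\<exists>N\<ge>1. \<forall>n\<ge>N. 1 / real n * (\<Sum>i<n. d (T (x k i)) (x k (Suc i))) < 1 / real (Suc k)"
      using N[of _ 0] by (intro exI[of _ N]) auto
  qed
  then obtain N where N: "\<And>k. N k \<ge> 1" "\<And>k n. n \<ge> N k \<Longrightarrow>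
      1 / real n * (\<Sum>i<n. d (T (x k i)) (x k (Suc i))) < 1 / real (Suc k)"
    by metis
  \<comment> \<open>The additive term covers times before \<open>N k\<close>, where each error is
    merely at most 1, so the bound holds for every \<open>n\<close>.\<close>
  have err: "(\<Sum>i<n. d (T (x k i)) (x k (Suc i))) \<le> real (N k) + 1 / real (Suc k) * real n" for k n
  proof (cases "n \<ge> N k")
    case True
    then have "(\<Sum>i<n. d (T (x k i)) (x k (Suc i))) \<le> 1 / real (Suc k) * real n"
      using N(2)[OF True] N(1)[of k] by (simp add: field_simps)
    then show ?thesis by simp
  next
    case False
    have "(\<Sum>i<n. d (T (x k i)) (x k (Suc i))) \<le> (\<Sum>i<n. 1)"
      by (intro sum_mono d_le_1 T_in xM)
    also have "\<dots> \<le> real (N k)" using False by simp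
    finally show ?thesis by (simp add: add_increasing2)
  qed
  have no: "\<not> mean_le (\<lambda>i. d (orbit_seq T y i) (x k i)) (\<epsilon>/2)" if "y \<in> M" for y k
  proof
    assume "mean_le (\<lambda>i. d (orbit_seq T y i) (x k i)) (\<epsilon>/2)"
    then have "besicovitch_seq d (orbit_seq T y) (x k) \<le> ereal (\<epsilon>/2)"
      by (rule besicovitch_seq_le)
    also have "\<dots> < ereal \<epsilon>" using eps by simp
    finally show False using x(2) that by blast
  qed
  have "\<forall>k s. \<exists>B. \<forall>y\<in>M. \<exists>m\<ge>s. m \<le> B \<and> \<epsilon>/2 * real m < (\<Sum>i<m. d (orbit_seq T y i) (x k i))"
    by (intro allI uniform_non_shadowing xM no)
  then obtain B where B: "\<And>k s y. y \<in> M \<Longrightarrow>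
      \<exists>m\<ge>s. m \<le> B k s \<and> \<epsilon>/2 * real m < (\<Sum>i<m. d (orbit_seq T y i) (x k i))"
    by metis
  \<comment> \<open>\<open>S k + B k (S k)\<close> leaves room in piece \<open>k\<close> to witness
    the failure of shadowing; \<open>Suc k * N (Suc k)\<close> makes the additive term of
    \<open>err\<close> negligible when piece \<open>Suc k\<close> begins.\<close>
  obtain S where S: "S 0 = 0" "strict_mono S" "\<And>k. Suc k * S k \<le> S (Suc k)"
      "\<And>k. S k + B k (S k) + Suc k * N (Suc k) \<le> S (Suc k)"
    using fast_sequence_exists[of "\<lambda>k s. s + B k s + Suc k * N (Suc k)"] by metis
  have SN: "k * N k \<le> S k" for k
    using S(4)[of "k - 1"] by (cases k) auto
  \<comment> \<open>Restarts \<open>x k\<close> at time \<open>S k\<close>. Earlier times give the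
    constant \<open>x k 0\<close> by truncated subtraction; it stays in \<open>M\<close> and is
    never read by \<open>join_pieces\<close>.\<close>
  define P where "P k i = x k (i - S k)" for k i
  let ?x = "join_pieces S P"
  have PM: "P k i \<in> M" for k i by (simp add: P_def xM)
  have "asymptotic_average_pseudo_orbit mtopology d T ?x"
  proof (rule asymptotic_average_pseudo_orbit_join_pieces[OF S(1-3) PM])
    fix c :: real assume c: "c > 0"
    obtain K :: nat where K: "2 / c < real K" using reals_Archimedean2 by blast
    show "\<exists>K. \<forall>k\<ge>K. \<forall>n. S k \<le> n \<longrightarrow> n \<le> S (Suc k) \<longrightarrow>
      (\<Sum>i\<in>{S k..<n}. d (T (P k i)) (P k (Suc i))) \<le> c * real n"
    proof (intro exI allI impI)
      fix k n assume k: "K \<le> k" "S k \<le> n" "n \<le> S (Suc k)"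
      have "(\<Sum>i\<in>{S k..<n}. d (T (P k i)) (P k (Suc i)))
          = (\<Sum>i<n - S k. d (T (x k i)) (x k (Suc i)))"
        by (rule sum.reindex_bij_witness[of _ "\<lambda>i. i + S k" "\<lambda>i. i - S k"])
           (auto simp: P_def Suc_diff_le)
      also have "\<dots> \<le> real (N k) + 1 / real (Suc k) * real (n - S k)" by (rule err)
      also have "\<dots> \<le> c/2 * real n + c/2 * real n"
      proof (rule add_mono)
        have ck: "2 / c < real k" using K k by linarith
        then have ck': "1 \<le> c/2 * real k" using c by (simp add: field_simps)
        have "1 * real (N k) \<le> c/2 * real k * real (N k)"
          by (rule mult_right_mono[OF ck']) simp
        also have "\<dots> = c/2 * real (k * N k)" by simp
        also have "\<dots> \<le> c/2 * real n"
          using SN[of k] k c by (intro mult_left_mono iffD2[OF of_nat_le_iff]) auto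
        finally show "real (N k) \<le> c/2 * real n" by simp
        have "1 / real (Suc k) \<le> c/2" using ck c by (simp add: field_simps)
        then show "1 / real (Suc k) * real (n - S k) \<le> c/2 * real n"
          using c by (intro mult_mono) auto
      qed
      finally show "(\<Sum>i\<in>{S k..<n}. d (T (P k i)) (P k (Suc i))) \<le> c * real n" by simp
    qed
  qed
  then obtain z where z: "z \<in> M" "besicovitch_seq d (orbit_seq T z) ?x = 0"
    using shadow unfolding asymptotic_average_shadowing_def by auto
  \<comment> \<open>The failure is measured on a window of length \<open>m\<close> starting at
    \<open>S k\<close>. Since \<open>m\<close> is at least \<open>S k\<close>, that window ends by
    \<open>2 * m\<close>, so an average of \<open>\<epsilon>/4\<close> from time 0 contradicts
    \<open>\<epsilon>/2\<close> on the window.\<close>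
  then have "mean_le (\<lambda>i. d (orbit_seq T z i) (?x i)) (\<epsilon>/4)"
    using eps by (simp add: besicovitch_seq_eq_0_iff)
  then obtain k where k: "\<And>n. n \<ge> k \<Longrightarrow> (\<Sum>i<n. d (orbit_seq T z i) (?x i)) \<le> \<epsilon>/4 * real n"
    unfolding mean_le_def eventually_sequentially by blast
  have Sk: "k \<le> S k" using strict_mono_imp_increasing[OF S(2)] .
  have "orbit_seq T z (S k) \<in> M" using z by auto
  then have "(T ^^ S k) z \<in> M" by (simp add: orbit_seq_def)
  then obtain m where m: "m \<ge> S k" "m \<le> B k (S k)"
      "\<epsilon>/2 * real m < (\<Sum>i<m. d (orbit_seq T ((T ^^ S k) z) i) (x k i))"
    using B by blast
  have "(\<Sum>i<m. d (orbit_seq T ((T ^^ S k) z) i) (x k i))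
      = (\<Sum>i\<in>{S k..<S k + m}. d (orbit_seq T z i) (?x i))"
    unfolding orbit_funpow
  proof (rule sum.reindex_bij_witness[of _ "\<lambda>i. i - S k" "\<lambda>i. i + S k"])
    fix i assume "i \<in> {..<m}"
    then have "join_pieces S P (i + S k) = x k i"
      using m S(4)[of k] by (subst join_pieces_eq[OF S(2), of k]) (auto simp: P_def)
    then show "d (orbit_seq T z (i + S k)) (join_pieces S P (i + S k)) = d (orbit_seq T z (S k + i)) (x k i)"
      by (simp add: add.commute)
  qed auto
  also have "\<dots> \<le> (\<Sum>i<S k + m. d (orbit_seq T z i) (?x i))"
    by (intro sum_mono2) auto
  also have "\<dots> \<le> \<epsilon>/4 * real (S k + m)" by (rule k) (use Sk in simp)
  also have "\<dots> \<le> \<epsilon>/4 * real (2 * m)" using eps m by (intro mult_left_mono) auto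
  finally show False using m by simp
qed

section \<open>Repairing an asymptotic average pseudo-orbit\<close>

text \<open>
  Blocks of length \<open>L\<close> with large average error have density zero; replacing each of them by a
  genuine orbit segment makes the error small on every block.
\<close>

lemma average_pseudo_orbit_repair:
  assumes x: "asymptotic_average_pseudo_orbit mtopology d T x" and "\<delta> > 0"
  obtains x' where "average_pseudo_orbit mtopology d T \<delta> x'"
    "\<And>c. c > 0 \<Longrightarrow> mean_le (\<lambda>i. d (x' i) (x i)) c"
proof -
  have xM: "x i \<in> M" for i using x by (simp add: asymptotic_average_pseudo_orbit_iff)
  define g where "g i = d (T (x i)) (x (Suc i))" for i
  have g: "mean_le g c" if "c > 0" for c
    using x that by (simp add: asymptotic_average_pseudo_orbit_iff g_def[abs_def])
  have g01: "0 \<le> g i" "g i \<le> 1" for i by (auto simp: g_def intro!: d_le_1 xM)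
  \<comment> \<open>Makes the jump between blocks cost less than \<open>\<delta>/4\<close> per unit
    of time; with the tolerated \<open>\<delta>/4\<close> inside a block this stays below
    \<open>\<delta>/2\<close>.\<close>
  obtain L :: nat where L: "4 / \<delta> < real L" using reals_Archimedean2 by blast
  then have L0: "L > 0" using \<open>\<delta> > 0\<close>
    by (metis divide_pos_pos less_trans of_nat_0_less_iff zero_less_numeral)
  define bad where "bad j \<longleftrightarrow> \<delta>/4 * real L < (\<Sum>i\<in>{j*L..<j*L+L}. g i)" for j
  define x' where "x' i = (if bad (i div L) then orbit_seq T (x (i div L * L)) (i mod L) else x i)" for i
  have x'M: "x' i \<in> M" for i using xM by (auto simp: x'_def)
  define e where "e i = d (T (x' i)) (x' (Suc i))" for i
  have e01: "0 \<le> e i" "e i \<le> 1" for i by (auto simp: e_def intro!: d_le_1 x'M)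
  have block: "i div L = j" if "i \<in> {j*L..<j*L+L}" for i j
    using that by (intro div_nat_eqI) (auto simp: mult.commute)
  have e_block: "(\<Sum>i\<in>{j*L..<j*L+L}. e i) \<le> \<delta>/4 * real L + 1" for j
  proof -
    let ?b = "\<lambda>i. if i = j*L+L-1 then 1 else 0 :: real"
    \<comment> \<open>A bad block carries a true orbit, hence has no inner error; \<open>?b\<close>
      pays for the step into the next block.\<close>
    let ?h = "\<lambda>i. if bad j then 0 else g i"
    have "(\<Sum>i\<in>{j*L..<j*L+L}. e i) \<le> (\<Sum>i\<in>{j*L..<j*L+L}. ?h i + ?b i)"
    proof (rule sum_mono)
      fix i assume i: "i \<in> {j*L..<j*L+L}"
      show "e i \<le> ?h i + ?b i"
      proof (cases "i = j*L+L-1")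
        case True
        then show ?thesis using e01(2)[of i] g01(1)[of i] by auto
      next
        case False
        then have Si: "Suc i \<in> {j*L..<j*L+L}" using i by auto
        have "Suc i mod L = Suc (i mod L)"
        proof -
          have "i = j * L + i mod L" "Suc i = j * L + Suc i mod L"
            using block[OF i] block[OF Si] div_mult_mod_eq[of i L] div_mult_mod_eq[of "Suc i" L]
            by simp_all
          then show ?thesis by linarith
        qed
        then have "e i = ?h i"
          using block[OF i] block[OF Si]
          by (auto simp: e_def x'_def g_def orbit_Suc xM intro!: mdist_zero T_in orbit_in)
        then show ?thesis by simp
      qed
    qed
    also have "\<dots> = (\<Sum>i\<in>{j*L..<j*L+L}. ?h i) + (\<Sum>i\<in>{j*L..<j*L+L}. ?b i)"
      by (rule sum.distrib)
    also have "\<dots> \<le> \<delta>/4 * real L + 1"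
    proof (rule add_mono)
      show "(\<Sum>i\<in>{j*L..<j*L+L}. ?h i) \<le> \<delta>/4 * real L"
        using \<open>\<delta> > 0\<close> by (cases "bad j") (auto simp: bad_def)
      show "(\<Sum>i\<in>{j*L..<j*L+L}. ?b i) \<le> 1" by (simp add: sum.delta)
    qed
    finally show ?thesis .
  qed
  define a where "a = \<delta>/4 * real L + 1"
  have a0: "a > 0" using \<open>\<delta> > 0\<close> by (simp add: a_def add_nonneg_pos)
  have aL: "a < \<delta>/2 * real L" using L \<open>\<delta> > 0\<close> by (simp add: a_def field_simps)
  \<comment> \<open>A window of length \<open>n\<close> meets at most \<open>n div L + 2\<close>
    aligned blocks wherever it starts, so the bound is uniform in \<open>k\<close>.\<close>
  have window: "(\<Sum>i<n. e (i + k)) \<le> \<delta>/2 * real n + 2 * a" for n k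
  proof -
    let ?p = "k div L" and ?r = "n div L + 2"
    have kL: "?p * L \<le> k" "k < ?p * L + L" and nL: "n div L * L \<le> n" "n < n div L * L + L"
      using L0 div_mult_mod_eq[of k L] mod_less_divisor[of L k]
        div_mult_mod_eq[of n L] mod_less_divisor[of L n] by linarith+
    have "(\<Sum>i<n. e (i + k)) = (\<Sum>i\<in>{k..<k+n}. e i)"
      by (rule sum.reindex_bij_witness[of _ "\<lambda>i. i - k" "\<lambda>i. i + k"]) auto
    also have "\<dots> \<le> (\<Sum>i\<in>{?p*L..<(?p+?r)*L}. e i)"
      using kL nL e01 by (intro sum_mono2) (auto simp: algebra_simps)
    also have "\<dots> \<le> real ?r * a"
      by (rule sum_blocks_le) (use e_block in \<open>simp add: a_def\<close>)
    also have "\<dots> = real (n div L) * a + 2 * a" by (simp add: algebra_simps)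
    also have "real (n div L) * a \<le> real (n div L) * (\<delta>/2 * real L)"
      using aL by (intro mult_left_mono) auto
    also have "\<dots> = \<delta>/2 * real (n div L * L)" by simp
    also have "\<dots> \<le> \<delta>/2 * real n"
      using nL \<open>\<delta> > 0\<close> by (intro mult_left_mono iffD2[OF of_nat_le_iff]) auto
    finally show ?thesis by simp
  qed
  have "average_pseudo_orbit mtopology d T \<delta> x'"
    unfolding average_pseudo_orbit_def topspace_mtopology
  proof (intro conjI allI)
    obtain N :: nat where N: "4 * a / \<delta> < real N" using reals_Archimedean2 by blast
    show "\<exists>N\<ge>1. \<forall>n\<ge>N. \<forall>k. 1 / real n * (\<Sum>i<n. d (T (x' (i + k))) (x' (i + k + 1))) < \<delta>"
    proof (intro exI[of _ "Suc N"] conjI allI impI)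
      fix n k assume n: "n \<ge> Suc N"
      have "4 * a / \<delta> < real n" using n N by simp
      then have "2 * a < \<delta>/2 * real n" using \<open>\<delta> > 0\<close> by (simp add: field_simps)
      then have "(\<Sum>i<n. e (i + k)) < \<delta> * real n" using window[of k n] by simp
      then show "1 / real n * (\<Sum>i<n. d (T (x' (i + k))) (x' (i + k + 1))) < \<delta>"
        using n by (simp add: e_def field_simps)
    qed simp
  qed (rule x'M)
  moreover have "mean_le (\<lambda>i. d (x' i) (x i)) c" if "c > 0" for c
  proof -
    \<comment> \<open>The change on a bad block is at most \<open>L\<close>, which badness bounds by
      \<open>4/\<delta>\<close> times its error sum; good blocks are unchanged. So \<open>x'\<close>
      differs from \<open>x\<close> on average by a multiple of the vanishing mean of
      \<open>g\<close>.\<close>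
    have block_le: "(\<Sum>i\<in>{j*L..<j*L+L}. d (x' i) (x i) - 4/\<delta> * g i) \<le> 0" for j
    proof (cases "bad j")
      case True
      have "(\<Sum>i\<in>{j*L..<j*L+L}. d (x' i) (x i)) \<le> (\<Sum>i\<in>{j*L..<j*L+L}. 1)"
        by (intro sum_mono d_le_1 x'M xM)
      also have "\<dots> = real L" by simp
      also have "\<dots> \<le> 4/\<delta> * (\<Sum>i\<in>{j*L..<j*L+L}. g i)"
        using True \<open>\<delta> > 0\<close> by (simp add: bad_def field_simps)
      finally show ?thesis by (simp add: sum_subtractf sum_distrib_left)
    next
      case False
      have "(\<Sum>i\<in>{j*L..<j*L+L}. d (x' i) (x i)) = 0"
        using False block[of _ j] by (intro sum.neutral) (auto simp: x'_def xM)
      moreover have "0 \<le> (\<Sum>i\<in>{j*L..<j*L+L}. 4/\<delta> * g i)"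
        using \<open>\<delta> > 0\<close> g01 by (intro sum_nonneg) auto
      ultimately show ?thesis by (simp add: sum_subtractf)
    qed
    \<comment> \<open>Rounding \<open>n\<close> up to whole blocks adds at most \<open>L\<close>
      terms of \<open>g\<close>, each at most 1.\<close>
    have main: "(\<Sum>i<n. d (x' i) (x i)) \<le> 4/\<delta> * (\<Sum>i<n. g i) + 4/\<delta> * real L" for n
    proof -
      let ?q = "n div L + 1"
      have q: "n \<le> ?q * L" "?q * L \<le> n + L"
        unfolding add_mult_distrib mult_1
        using L0 div_mult_mod_eq[of n L] mod_less_divisor[of L n] by linarith+
      have "(\<Sum>i<n. d (x' i) (x i)) \<le> (\<Sum>i<?q*L. d (x' i) (x i))"
        using q by (intro sum_mono2) auto
      also have "\<dots> \<le> 4/\<delta> * (\<Sum>i<?q*L. g i)"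
        using sum_blocks_le[where p = 0 and r = ?q, OF block_le]
        by (simp add: sum_subtractf sum_distrib_left atLeast0LessThan)
      also have "(\<Sum>i<?q*L. g i) \<le> (\<Sum>i<n + L. g i)"
        using q g01 by (intro sum_mono2) auto
      also have "\<dots> = (\<Sum>i<n. g i) + (\<Sum>i<L. g (n + i))"
        by (induction L) (simp_all add: algebra_simps)
      also have "(\<Sum>i<L. g (n + i)) \<le> (\<Sum>i<L. 1)" by (intro sum_mono g01)
      finally show ?thesis using \<open>\<delta> > 0\<close> by (simp add: algebra_simps divide_right_mono)
    qed
    obtain N :: nat where N: "8 / \<delta> * real L / c < real N" using reals_Archimedean2 by blast
    have "mean_le g (\<delta> * c / 8)" using g \<open>\<delta> > 0\<close> \<open>c > 0\<close> by simp
    then show ?thesis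
      unfolding mean_le_def using eventually_ge_at_top[of N]
    proof eventually_elim
      case (elim n)
      have "8 / \<delta> * real L / c < real n" using elim N by linarith
      then have "4 / \<delta> * real L \<le> c/2 * real n" using \<open>c > 0\<close> \<open>\<delta> > 0\<close> by (simp add: field_simps)
      moreover have "4/\<delta> * (\<Sum>i<n. g i) \<le> 4/\<delta> * (\<delta> * c / 8 * real n)"
        using elim \<open>\<delta> > 0\<close> by (intro mult_left_mono) auto
      moreover have "4/\<delta> * (\<delta> * c / 8 * real n) = c/2 * real n" using \<open>\<delta> > 0\<close> by simp
      ultimately show ?case using main[of n] by simp
    qed
  qed
  ultimately show thesis by (rule that)
qed

section \<open>Completeness and average shadowing imply asymptotic average shadowing\<close>

lemma complete_average_shadowing_imp_asymptotic:
  assumes complete: "besicovitch_complete mtopology d T"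
    and shadow: "average_shadowing mtopology d T"
  shows "asymptotic_average_shadowing mtopology d T"
  unfolding asymptotic_average_shadowing_def topspace_mtopology
proof (intro allI impI)
  fix x assume x: "asymptotic_average_pseudo_orbit mtopology d T x"
  then have xM: "x i \<in> M" for i by (simp add: asymptotic_average_pseudo_orbit_iff)
  \<comment> \<open>The repaired sequence is at Besicovitch distance 0 from \<open>x\<close>, so
    shadowing it within \<open>\<epsilon>/2\<close> leaves \<open>\<epsilon>/2\<close> for passing
    back to \<open>x\<close>.\<close>
  have ex: "\<exists>z\<in>M. mean_le (\<lambda>i. d (orbit_seq T z i) (x i)) \<epsilon>" if "\<epsilon> > 0" for \<epsilon>
  proof -
    obtain \<delta> where \<delta>: "\<delta> > 0" "\<And>x. average_pseudo_orbit mtopology d T \<delta> x \<Longrightarrow>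
        \<exists>z\<in>M. besicovitch_seq d (orbit_seq T z) x < ereal (\<epsilon>/2)"
      using shadow \<open>\<epsilon> > 0\<close> unfolding average_shadowing_def topspace_mtopology
      by (meson half_gt_zero)
    obtain x' where x': "average_pseudo_orbit mtopology d T \<delta> x'"
        "\<And>c. c > 0 \<Longrightarrow> mean_le (\<lambda>i. d (x' i) (x i)) c"
      using average_pseudo_orbit_repair[OF x \<delta>(1)] by blast
    obtain z where z: "z \<in> M" "besicovitch_seq d (orbit_seq T z) x' < ereal (\<epsilon>/2)"
      using \<delta>(2)[OF x'(1)] by blast
    have "mean_le (\<lambda>i. d (orbit_seq T z i) (x i)) (\<epsilon>/2 + \<epsilon>/2)"
      by (rule mean_le_dist_trans[OF _ _ xM besicovitch_seq_lessD[OF z(2)] x'(2)])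
         (use z x'(1) \<open>\<epsilon> > 0\<close> in \<open>auto simp: average_pseudo_orbit_def\<close>)
    then show ?thesis using z by auto
  qed
  have "\<forall>k. \<exists>z\<in>M. mean_le (\<lambda>i. d (orbit_seq T z i) (x i)) (1 / real (Suc k))"
    using ex by (simp del: of_nat_Suc)
  then obtain z where z: "\<And>k. z k \<in> M"
      "\<And>k. mean_le (\<lambda>i. d (orbit_seq T (z k) i) (x i)) (1 / real (Suc k))"
    by metis
  have small: "\<exists>N\<ge>1. \<forall>n\<ge>N. 1 / real (Suc n) < \<epsilon>" if "\<epsilon> > 0" for \<epsilon> :: real
  proof -
    obtain N :: nat where N: "1 / \<epsilon> < real N" using reals_Archimedean2 by blast
    have "1 / real (Suc n) < \<epsilon>" if "n \<ge> Suc N" for n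
    proof -
      have "1 / \<epsilon> < real (Suc n)" using N that by simp
      then show ?thesis using \<open>\<epsilon> > 0\<close> by (simp add: field_simps)
    qed
    then show ?thesis by (intro exI[of _ "Suc N"]) auto
  qed
  have "besicovitch_Cauchy d T z"
    unfolding besicovitch_Cauchy_def
  proof (intro allI impI)
    fix \<epsilon> :: real assume "\<epsilon> > 0"
    then obtain N where N: "N \<ge> 1" "\<And>n. n \<ge> N \<Longrightarrow> 1 / real (Suc n) < \<epsilon>/2"
      using small[of "\<epsilon>/2"] by auto
    show "\<exists>N\<ge>1. \<forall>n\<ge>N. \<forall>m\<ge>N. besicovitch d T (z n) (z m) < ereal \<epsilon>"
    proof (intro exI conjI allI impI)
      fix n m assume nm: "n \<ge> N" "m \<ge> N"
      have "mean_le (\<lambda>i. d (x i) (orbit_seq T (z m) i)) (1 / real (Suc m))"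
        using z(2)[of m] by (simp only: commute)
      then have "mean_le (\<lambda>i. d (orbit_seq T (z n) i) (orbit_seq T (z m) i))
          (1 / real (Suc n) + 1 / real (Suc m))"
        by (rule mean_le_dist_trans[rotated 4, where y = x]) (use z xM in auto)
      then have "besicovitch d T (z n) (z m) \<le> ereal (1 / real (Suc n) + 1 / real (Suc m))"
        unfolding besicovitch_def by (rule besicovitch_seq_le)
      also have "\<dots> < ereal \<epsilon>"
        using N(2)[OF nm(1)] N(2)[OF nm(2)] by simp
      finally show "besicovitch d T (z n) (z m) < ereal \<epsilon>" .
    qed (rule N)
  qed
  then obtain y where y: "y \<in> M" "(\<lambda>n. besicovitch d T (z n) y) \<longlonglongrightarrow> 0"
    using complete z(1) unfolding besicovitch_complete_def by auto
  \<comment> \<open>A single late \<open>z n\<close> serves as the intermediate point, close both to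
    the limit \<open>y\<close> and to \<open>x\<close>.\<close>
  have "mean_le (\<lambda>i. d (orbit_seq T y i) (x i)) c" if "c > 0" for c
  proof -
    obtain N where N: "\<And>n. n \<ge> N \<Longrightarrow> 1 / real (Suc n) < c/2"
      using small[of "c/2"] \<open>c > 0\<close> by auto
    have "\<forall>\<^sub>F n in sequentially. besicovitch d T (z n) y < ereal (c/2)"
      using order_tendstoD(2)[OF y(2)] \<open>c > 0\<close> by simp
    then have "\<forall>\<^sub>F n in sequentially. besicovitch d T (z n) y < ereal (c/2) \<and> n \<ge> N"
      by (rule eventually_conj) (rule eventually_ge_at_top)
    then obtain n where n: "besicovitch d T (z n) y < ereal (c/2)" "n \<ge> N"
      using eventually_happens'[OF sequentially_bot] by blast
    have 1: "mean_le (\<lambda>i. d (orbit_seq T y i) (orbit_seq T (z n) i)) (c/2)"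
      using besicovitch_seq_lessD[OF n(1)[unfolded besicovitch_def]] by (simp only: commute)
    have "mean_le (\<lambda>i. d (orbit_seq T y i) (x i)) (c/2 + 1 / real (Suc n))"
      by (rule mean_le_dist_trans[OF _ _ xM 1 z(2)]) (use z y in auto)
    then show ?thesis
      unfolding mean_le_def
    proof eventually_elim
      case (elim l)
      have "(c/2 + 1 / real (Suc n)) * real l \<le> c * real l"
        using N[OF n(2)] by (intro mult_right_mono) auto
      with elim show ?case by linarith
    qed
  qed
  then show "\<exists>z\<in>M. besicovitch_seq d (orbit_seq T z) x = 0"
    using y by (auto simp: besicovitch_seq_eq_0_iff)
qed

end

theorem theorem3:
  fixes X :: "'a topology" and T :: "'a \<Rightarrow> 'a" and \<rho> :: "'a \<Rightarrow> 'a \<Rightarrow> real"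
  assumes "topological_dynamical_system X T"
    and "compatible_metric X \<rho>"
    and "\<forall>x\<in>topspace X. \<forall>y\<in>topspace X. \<rho> x y \<le> 1"
    and "T ` topspace X = topspace X"
  shows "asymptotic_average_shadowing X \<rho> T \<longleftrightarrow>
         besicovitch_complete X \<rho> T \<and> average_shadowing X \<rho> T"
proof -
  interpret Metric_space "topspace X" \<rho>
    using assms(2) by (simp add: compatible_metric_def)
  have X: "mtopology = X"
    using assms(2) by (simp add: compatible_metric_def)
  interpret bounded_compact_system "topspace X" \<rho> T
    by unfold_locales (use assms in \<open>auto simp: X topological_dynamical_system_def\<close>)
  show ?thesis
    using asymptotic_shadowing_imp_complete asymptotic_shadowing_imp_average_shadowing
      complete_average_shadowing_imp_asymptotic
    unfolding X by blast
qed

end
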